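(* Let $T$ be a finite tree, let $F\subseteq E(T)$ be a subset of its edges, and let $G$ be the line graph of $F$, i.e. the graph with vertex set $F$ in which two distinct edges $e,e'\in F$ are adjacent if and only if they share a vertex of $T$. Then for every integral weight function $w:F\to\mathbb{N}$ one has $\gamma_w(G)=\rho_w(G)$.
   Context: All graphs are finite and simple, and $\mathbb{N}=\{0,1,2,\dots\}$. For a vertex $v$ of a graph $G=(V,E)$, $N(v)$ denotes the closed neighborhood of $v$, i.e. $v$ together with all vertices adjacent to $v$. For a real valued function $f$ on $V$ and $A\subseteq V$, write $f[A]=\sum_{a\in A}f(a)$, and $|f|=f[V]$ is called the size of $f$. Given $w:V\to\mathbb{N}$, a nonnegative function $f$ on $V$ is $w$-dominating if $f[N(u)]\ge w(u)$ for every $u\in V$. The weighted domination number $\gamma_w(G)$ is the minimal size $|f|$ of an integer valued nonnegative $w$-dominating function $f:V\to\mathbb{N}$. A set of vertices of $G$ is dispersed if every two distinct elements of it are at distance at least $3$ in $G$ (vertices in different connected components are at infinite distance). $\rho_w(G)$ is the maximum of $w[I]$ over all dispersed sets $I\subseteq V$. *)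

theory Defs
  imports Complex_Main "HOL-Library.Extended_Nat"
begin

section \<open>Finite simple graphs\<close>

record 'a ugraph =
  verts :: "'a set"
  edges :: "'a set set"

definition simple_graph :: "'a ugraph \<Rightarrow> bool" where
  "simple_graph G \<longleftrightarrow>
     finite (verts G) \<and> (\<forall>e \<in> edges G. e \<subseteq> verts G \<and> card e = 2)"

definition adjacent :: "'a ugraph \<Rightarrow> 'a \<Rightarrow> 'a \<Rightarrow> bool" where
  "adjacent G u v \<longleftrightarrow> {u, v} \<in> edges G"

definition walk :: "'a ugraph \<Rightarrow> 'a \<Rightarrow> 'a list \<Rightarrow> 'a \<Rightarrow> bool" where
  "walk G u p v \<longleftrightarrow>
     p \<noteq> [] \<and> set p \<subseteq> verts G \<and> successively (adjacent G) p \<and> hd p = u \<and> last p = v"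

definition connected_graph :: "'a ugraph \<Rightarrow> bool" where
  "connected_graph G \<longleftrightarrow>
     verts G \<noteq> {} \<and> (\<forall>u \<in> verts G. \<forall>v \<in> verts G. \<exists>p. walk G u p v)"

text \<open>A cycle is listed without repeating its first vertex at the end.\<close>

definition graph_cycle :: "'a ugraph \<Rightarrow> 'a list \<Rightarrow> bool" where
  "graph_cycle G p \<longleftrightarrow>
     3 \<le> length p \<and> distinct p \<and> walk G (hd p) p (last p) \<and> adjacent G (last p) (hd p)"

definition finite_tree :: "'a ugraph \<Rightarrow> bool" where
  "finite_tree T \<longleftrightarrow>
     simple_graph T \<and> connected_graph T \<and> (\<nexists>p. graph_cycle T p)"

text \<open>A walk is given by its vertices, so it has length \<open>length p - 1\<close>; the infimum over
  the empty set is \<open>\<infinity>\<close>, the distance between different components.\<close>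

definition gdist :: "'a ugraph \<Rightarrow> 'a \<Rightarrow> 'a \<Rightarrow> enat" where
  "gdist G u v = (INF p \<in> {p. walk G u p v}. enat (length p - 1))"

definition line_graph :: "'a set set \<Rightarrow> 'a set ugraph" where
  "line_graph F =
     \<lparr>verts = F, edges = {{e, e'} | e e'. e \<in> F \<and> e' \<in> F \<and> e \<noteq> e' \<and> e \<inter> e' \<noteq> {}}\<rparr>"

section \<open>Weighted domination and dispersed sets\<close>

definition closed_nbhd :: "'a ugraph \<Rightarrow> 'a \<Rightarrow> 'a set" where
  "closed_nbhd G v = insert v {u \<in> verts G. adjacent G v u}"

definition dominating :: "'a ugraph \<Rightarrow> ('a \<Rightarrow> nat) \<Rightarrow> ('a \<Rightarrow> real) \<Rightarrow> bool" where
  "dominating G w f \<longleftrightarrow>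
     (\<forall>u \<in> verts G. 0 \<le> f u) \<and> (\<forall>u \<in> verts G. real (w u) \<le> sum f (closed_nbhd G u))"

definition wdom_number :: "'a ugraph \<Rightarrow> ('a \<Rightarrow> nat) \<Rightarrow> nat" where
  "wdom_number G w =
     (LEAST n. \<exists>f :: 'a \<Rightarrow> nat. dominating G w (\<lambda>v. real (f v)) \<and> n = sum f (verts G))"

definition dispersed :: "'a ugraph \<Rightarrow> 'a set \<Rightarrow> bool" where
  "dispersed G I \<longleftrightarrow> I \<subseteq> verts G \<and> pairwise (\<lambda>u v. 3 \<le> gdist G u v) I"

definition disp_number :: "'a ugraph \<Rightarrow> ('a \<Rightarrow> nat) \<Rightarrow> nat" where
  "disp_number G w = Max {sum w I | I. dispersed G I}"

text \<open>On finite simple graphs the minimum and the maximum above are attained.\<close>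

lemma wdom_number_attained:
  assumes "simple_graph G"
  shows "\<exists>f :: 'a \<Rightarrow> nat. dominating G w (\<lambda>v. real (f v)) \<and> wdom_number G w = sum f (verts (G :: 'a ugraph))"
  unfolding wdom_number_def
proof (rule LeastI_ex)
  have "dominating G w (\<lambda>v. real (w v))"
    unfolding dominating_def
  proof (intro conjI ballI)
    fix u assume "u \<in> verts G"
    have "finite (closed_nbhd G u)"
      using assms by (simp add: closed_nbhd_def simple_graph_def)
    then show "real (w u) \<le> (\<Sum>v\<in>closed_nbhd G u. real (w v))"
      by (intro member_le_sum) (auto simp: closed_nbhd_def)
  qed simp
  then show "\<exists>n f. dominating G w (\<lambda>v. real (f v)) \<and> n = sum f (verts G)"
    by blast
qed

lemma disp_number_attained:
  assumes "simple_graph G"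
  shows "\<exists>I. dispersed G I \<and> disp_number G w = sum w I"
proof -
  have "finite {I. dispersed G I}"
    by (rule finite_subset[of _ "Pow (verts G)"])
       (use assms in \<open>auto simp: dispersed_def simple_graph_def\<close>)
  then have "finite {sum w I | I. dispersed G I}"
    by simp
  moreover have "dispersed G {}"
    by (simp add: dispersed_def)
  then have "{sum w I | I. dispersed G I} \<noteq> {}"
    by blast
  ultimately show ?thesis
    using Max_in unfolding disp_number_def by fastforce
qed

lemma simple_graph_line_graph:
  assumes "simple_graph G" "F \<subseteq> edges G"
  shows "simple_graph (line_graph F)"
proof -
  have "edges G \<subseteq> Pow (verts G)" "finite (verts G)"
    using assms(1) by (auto simp: simple_graph_def)
  then have "finite F"
    using assms(2) by (meson finite_Pow_iff finite_subset)
  then show ?thesis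
    by (auto simp: simple_graph_def line_graph_def card_insert_if)
qed

lemma adjacent_line_graph:
  "adjacent (line_graph F) e e' \<longleftrightarrow> e \<in> F \<and> e' \<in> F \<and> e \<noteq> e' \<and> e \<inter> e' \<noteq> {}"
  unfolding adjacent_def line_graph_def by (auto simp: doubleton_eq_iff)

end

theory Submission
  imports Defs
begin

text \<open>
  A dispersed set has pairwise disjoint closed neighborhoods, and a \<open>w\<close>-dominating function
  has mass at least \<open>w u\<close> on the closed neighborhood of \<open>u\<close>; so \<open>\<rho>\<^sub>w \<le> \<gamma>\<^sub>w\<close> in every graph.

  For the converse, call a vertex \<open>e\<close> of a set \<open>S\<close> of vertices simple in \<open>S\<close> if some
  \<open>t \<in> N(e)\<close> lies in \<open>N(h)\<close> for every \<open>h \<in> S\<close> with \<open>N(h) \<inter> N(e) \<noteq> {}\<close>. If every nonempty set of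
  vertices has such an \<open>e\<close>, then \<open>\<gamma>\<^sub>w \<le> \<rho>\<^sub>w\<close> follows by induction on the total weight
  (\<open>dominating_dispersed_pair\<close>): choose \<open>e\<close> simple in the support of \<open>w\<close>, lower all positive
  weights on \<open>N(t)\<close> by one, and take an optimal pair \<open>(f, I)\<close> for the new weights. Raising \<open>f t\<close>
  by one gives a \<open>w\<close>-dominating function. Either \<open>I\<close> contains a vertex of \<open>N(t)\<close> of positive
  weight, so that its \<open>w\<close>-weight exceeds its new weight by at least one; or, after the vertices
  of new weight zero are discarded from \<open>I\<close>, the set \<open>I \<union> {e}\<close> is dispersed, and \<open>w e \<ge> 1\<close>.

  For the line graph of a set \<open>F\<close> of edges of a tree, orient every edge of \<open>F\<close> as \<open>{v, par v}\<close>,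
  where the depth of \<open>v\<close> exceeds that of \<open>par v\<close> by one (\<open>acyclic_parent\<close>, proved by
  removing leaves). An edge \<open>{v, par v}\<close> of maximal depth in \<open>S\<close> is then simple in \<open>S\<close>, with
  \<open>t\<close> the edge above \<open>par v\<close> if it belongs to \<open>F\<close>, and \<open>t = {v, par v}\<close> otherwise
  (\<open>line_graph_simple_edge\<close>).
\<close>

section \<open>Dispersed sets and closed neighborhoods\<close>

lemma adjacent_sym: "adjacent G u v \<longleftrightarrow> adjacent G v u"
  by (simp add: adjacent_def insert_commute)

lemma closed_nbhd_subset: "v \<in> verts G \<Longrightarrow> closed_nbhd G v \<subseteq> verts G"
  by (auto simp: closed_nbhd_def)

lemma gdist_ge_3_iff:
  assumes "u \<in> verts G" "v \<in> verts G" "u \<noteq> v"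
  shows "3 \<le> gdist G u v \<longleftrightarrow> closed_nbhd G u \<inter> closed_nbhd G v = {}"
proof
  assume far: "3 \<le> gdist G u v"
  have long: "4 \<le> length p" if "walk G u p v" for p
  proof -
    have "gdist G u v \<le> enat (length p - 1)"
      unfolding gdist_def by (rule INF_lower) (use that in simp)
    with far have "3 \<le> enat (length p - 1)" by (rule order_trans)
    then have "enat 3 \<le> enat (length p - 1)" by (simp only: numeral_eq_enat)
    then show ?thesis by simp
  qed
  show "closed_nbhd G u \<inter> closed_nbhd G v = {}"
  proof (rule ccontr)
    assume "closed_nbhd G u \<inter> closed_nbhd G v \<noteq> {}"
    then obtain x where "x \<in> closed_nbhd G u" "x \<in> closed_nbhd G v" by blast
    then have "walk G u [u, v] v \<or> walk G u [u, x, v] v"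
      using assms by (auto simp: closed_nbhd_def walk_def adjacent_sym)
    then show False using long by fastforce
  qed
next
  assume disj: "closed_nbhd G u \<inter> closed_nbhd G v = {}"
  have "3 \<le> enat (length p - 1)" if p: "walk G u p v" for p
  proof -
    have "4 \<le> length p"
    proof (rule ccontr)
      assume "\<not> 4 \<le> length p"
      then have "length p = 0 \<or> length p = 1 \<or> length p = 2 \<or> length p = 3" by linarith
      then obtain x y z where "p = [] \<or> p = [x] \<or> p = [x, y] \<or> p = [x, y, z]"
        by (auto simp: numeral_eq_Suc length_Suc_conv)
      then show False
        using p assms disj by (auto simp: closed_nbhd_def walk_def adjacent_sym)
    qed
    then show ?thesis by (simp add: numeral_eq_enat)
  qed
  then show "3 \<le> gdist G u v"
    unfolding gdist_def by (auto intro: INF_greatest)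
qed

lemma dispersed_iff:
  "dispersed G I \<longleftrightarrow>
     I \<subseteq> verts G \<and> pairwise (\<lambda>u v. closed_nbhd G u \<inter> closed_nbhd G v = {}) I"
  unfolding dispersed_def pairwise_def
  by (simp add: gdist_ge_3_iff subset_iff cong: conj_cong)

section \<open>Duality between domination and dispersion\<close>

lemma dispersed_weight_le:
  fixes f :: "'a \<Rightarrow> nat"
  assumes "simple_graph G" "dispersed G I" "dominating G w (\<lambda>v. real (f v))"
  shows "sum w I \<le> sum f (verts G)"
proof -
  have fin: "finite (verts G)" and I: "I \<subseteq> verts G"
    using assms by (auto simp: simple_graph_def dispersed_def)
  have "w u \<le> sum f (closed_nbhd G u)" if "u \<in> I" for u
  proof -
    have "real (w u) \<le> real (sum f (closed_nbhd G u))"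
      using assms(3) I that by (auto simp: dominating_def)
    then show ?thesis by (simp only: of_nat_le_iff)
  qed
  then have "sum w I \<le> (\<Sum>u\<in>I. sum f (closed_nbhd G u))"
    by (rule sum_mono)
  also have "\<dots> = sum f (\<Union>u\<in>I. closed_nbhd G u)"
    using assms(2) fin I closed_nbhd_subset[of _ G]
    by (intro sum.UNION_disjoint[symmetric])
       (auto simp: dispersed_iff pairwise_def subset_iff intro!: finite_subset[OF _ fin])
  also have "\<dots> \<le> sum f (verts G)"
    using fin I closed_nbhd_subset[of _ G] by (intro sum_mono2) auto
  finally show ?thesis .
qed

lemma dominating_dispersed_pair:
  fixes w :: "'a \<Rightarrow> nat"
  assumes G: "simple_graph G"
    and simple: "\<And>S. S \<subseteq> verts G \<Longrightarrow> S \<noteq> {} \<Longrightarrow>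
      \<exists>e\<in>S. \<exists>t\<in>closed_nbhd G e. \<forall>h\<in>S.
        closed_nbhd G h \<inter> closed_nbhd G e \<noteq> {} \<longrightarrow> t \<in> closed_nbhd G h"
  shows "\<exists>(f :: 'a \<Rightarrow> nat) I. (\<forall>u\<in>verts G. w u \<le> sum f (closed_nbhd G u)) \<and>
    dispersed G I \<and> sum f (verts G) \<le> sum w I"
proof (induction "sum w (verts G)" arbitrary: w rule: less_induct)
  case less
  let ?N = "closed_nbhd G"
  have fin: "finite (verts G)" using G by (simp add: simple_graph_def)
  define S where "S = {u \<in> verts G. 0 < w u}"
  show ?case
  proof (cases "S = {}")
    case True
    then have "\<forall>u\<in>verts G. w u \<le> sum (\<lambda>_. 0) (?N u)"
      by (auto simp: S_def)
    moreover have "dispersed G {}" by (simp add: dispersed_def)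
    ultimately show ?thesis by (intro exI[of _ "\<lambda>_. 0"] exI[of _ "{}"]) simp
  next
    case False
    then obtain e t where e: "e \<in> S" and t: "t \<in> ?N e"
      and et: "\<And>h. h \<in> S \<Longrightarrow> ?N h \<inter> ?N e \<noteq> {} \<Longrightarrow> t \<in> ?N h"
      using simple[of S] unfolding S_def by blast
    have eV: "e \<in> verts G" and we: "0 < w e" using e by (auto simp: S_def)
    have tV: "t \<in> verts G" using t eV closed_nbhd_subset by fastforce
    define w' where "w' u = (if t \<in> ?N u then w u - 1 else w u)" for u
    have w'_le: "w' u \<le> w u" for u by (simp add: w'_def)
    have "sum w' (verts G) < sum w (verts G)"
    proof (rule sum_strict_mono_ex1)
      show "\<exists>a\<in>verts G. w' a < w a"
        using eV we t by (intro bexI[of _ e]) (auto simp: w'_def)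
    qed (use fin w'_le in auto)
    from less[OF this] obtain f I where
      f: "\<And>u. u \<in> verts G \<Longrightarrow> w' u \<le> sum f (?N u)" and
      I: "dispersed G I" and fI: "sum f (verts G) \<le> sum w' I"
      by blast
    define g where "g u = f u + of_bool (u = t)" for u
    have sum_g: "sum g A = sum f A + of_bool (t \<in> A)" if "finite A" for A
      using that by (simp add: g_def sum.distrib of_bool_def)
    have g_dom: "w u \<le> sum g (?N u)" if u: "u \<in> verts G" for u
    proof -
      have "finite (?N u)" using u fin closed_nbhd_subset finite_subset by metis
      then show ?thesis using f[OF u] by (simp add: sum_g w'_def split: if_splits)
    qed
    have g_size: "sum g (verts G) = Suc (sum f (verts G))"
      using fin tV by (simp add: sum_g)
    define J where "J = {u \<in> I. 0 < w' u}"
    have IV: "I \<subseteq> verts G" and finI: "finite I"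
      using I fin finite_subset by (auto simp: dispersed_def)
    have "\<exists>K. dispersed G K \<and> Suc (sum w' I) \<le> sum w K"
    proof (cases "\<exists>h\<in>I. 0 < w h \<and> t \<in> ?N h")
      case True
      then obtain h where h: "h \<in> I" "0 < w h" "t \<in> ?N h" by blast
      have "sum w' I < sum w I"
        using h w'_le finI
        by (intro sum_strict_mono_ex1) (auto simp: w'_def intro!: bexI[of _ h])
      then show ?thesis using I by (intro exI[of _ I]) simp
    next
      case False
      have JS: "J \<subseteq> S" "J \<subseteq> I" and t_notin: "\<And>h. h \<in> J \<Longrightarrow> t \<notin> ?N h"
        using False IV by (auto simp: J_def S_def w'_def split: if_splits)
      then have disj: "?N h \<inter> ?N e = {}" if "h \<in> J" for h
        using that et by blast
      have "dispersed G (insert e J)"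
        using I JS disj eV unfolding dispersed_iff pairwise_insert
        by (blast intro: pairwise_subset)
      moreover have "Suc (sum w' I) \<le> sum w (insert e J)"
      proof -
        have "sum w' I = sum w' J"
          using finI by (intro sum.mono_neutral_right) (auto simp: J_def)
        also have "\<dots> \<le> sum w J" by (intro sum_mono w'_le)
        finally show ?thesis
          using we t t_notin finI JS finite_subset[of J I] by (subst sum.insert) auto
      qed
      ultimately show ?thesis by blast
    qed
    then show ?thesis using g_dom g_size fI by (metis Suc_le_mono order_trans)
  qed
qed

lemma wdom_number_eq_disp_number:
  fixes w :: "'a \<Rightarrow> nat"
  assumes G: "simple_graph G"
    and simple: "\<And>S. S \<subseteq> verts G \<Longrightarrow> S \<noteq> {} \<Longrightarrow>
      \<exists>e\<in>S. \<exists>t\<in>closed_nbhd G e. \<forall>h\<in>S.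
        closed_nbhd G h \<inter> closed_nbhd G e \<noteq> {} \<longrightarrow> t \<in> closed_nbhd G h"
  shows "wdom_number G w = disp_number G w"
proof (rule antisym)
  obtain f :: "'a \<Rightarrow> nat" and I where
    f: "\<forall>u\<in>verts G. w u \<le> sum f (closed_nbhd G u)" and
    I: "dispersed G I" and fI: "sum f (verts G) \<le> sum w I"
    using dominating_dispersed_pair[OF assms, of w] by blast
  have "dominating G w (\<lambda>v. real (f v))"
    using f by (simp add: dominating_def flip: of_nat_sum)
  then have "wdom_number G w \<le> sum f (verts G)"
    unfolding wdom_number_def by (intro Least_le) blast
  also have "\<dots> \<le> sum w I" by (rule fI)
  also have "\<dots> \<le> disp_number G w"
  proof -
    have "finite {I. dispersed G I}"
      by (rule finite_subset[of _ "Pow (verts G)"])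
         (use G in \<open>auto simp: dispersed_def simple_graph_def\<close>)
    then show ?thesis
      unfolding disp_number_def using I by (intro Max_ge) auto
  qed
  finally show "wdom_number G w \<le> disp_number G w" .
next
  show "disp_number G w \<le> wdom_number G w"
    using wdom_number_attained[OF G, of w] disp_number_attained[OF G, of w]
      dispersed_weight_le[OF G] by metis
qed

section \<open>Parents and depths in a finite forest\<close>

text \<open>A cycle all of whose edges belong to \<open>F\<close>, listed without repeating its first vertex.\<close>

definition edge_cycle :: "'a set set \<Rightarrow> 'a list \<Rightarrow> bool" where
  "edge_cycle F p \<longleftrightarrow> 3 \<le> length p \<and> distinct p \<and>
     successively (\<lambda>u v. {u, v} \<in> F) p \<and> {last p, hd p} \<in> F"

lemma path_verts_subset_Union:
  assumes "2 \<le> length p" "successively (\<lambda>u v. {u, v} \<in> F) p"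
  shows "set p \<subseteq> \<Union>F"
proof
  fix x assume "x \<in> set p"
  then obtain i where i: "i < length p" "x = p ! i" by (auto simp: in_set_conv_nth)
  have "\<exists>j. Suc j < length p \<and> (i = j \<or> i = Suc j)"
    using assms(1) i by (cases i) auto
  then show "x \<in> \<Union>F"
    using assms(2) i(2) by (auto simp: successively_conv_nth)
qed

text \<open>The first vertex of a longest path is a leaf: any further neighbor of it would extend the
  path or close a cycle.\<close>

lemma acyclic_leaf:
  assumes fin: "finite F" and card: "\<And>e. e \<in> F \<Longrightarrow> card e = 2"
    and acyc: "\<nexists>p. edge_cycle F p" and ne: "F \<noteq> {}"
  shows "\<exists>a b. a \<noteq> b \<and> {a, b} \<in> F \<and> (\<forall>e\<in>F. a \<in> e \<longrightarrow> e = {a, b})"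
proof -
  define P where "P p \<longleftrightarrow> 2 \<le> length p \<and> distinct p \<and> successively (\<lambda>u v. {u, v} \<in> F) p" for p
  have finU: "finite (\<Union>F)"
    using fin card by (intro finite_Union) (simp_all add: card_ge_0_finite)
  have in_U: "set p \<subseteq> \<Union>F" if "P p" for p
    using that unfolding P_def by (blast intro: path_verts_subset_Union[THEN subsetD])
  have bound: "length p < Suc (card (\<Union>F))" if "P p" for p
    using card_mono[OF finU in_U[OF that]] that by (simp add: P_def distinct_card)
  obtain x y where "x \<noteq> y" "{x, y} \<in> F"
    using ne card by (metis card_2_iff ex_in_conv)
  then have "P [x, y]" by (simp add: P_def)
  then obtain p where p: "P p" and longest: "\<And>q. P q \<Longrightarrow> length q \<le> length p"
    using ex_has_greatest_nat[of P _ length "Suc (card (\<Union>F))"] bound by (metis less_imp_le)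
  then obtain a b r where abr: "p = a # b # r"
    by (metis P_def Suc_le_length_iff numeral_2_eq_2)
  have ab: "a \<noteq> b" "{a, b} \<in> F" using p by (auto simp: P_def abr)
  have "e = {a, b}" if e: "e \<in> F" "a \<in> e" for e
  proof (rule ccontr)
    assume "e \<noteq> {a, b}"
    then obtain c where c: "e = {a, c}" "c \<noteq> a" "c \<noteq> b"
      using card[OF e(1)] e(2) by (auto simp: card_2_iff)
    show False
    proof (cases "c \<in> set p")
      case False
      then have "P (c # p)"
        using p e(1) c by (auto simp: P_def abr insert_commute)
      then show False using longest by fastforce
    next
      case True
      then obtain xs ys where r: "r = xs @ c # ys"
        using c by (auto simp: abr dest: split_list)
      have "edge_cycle F (a # b # xs @ [c])"
        using p e(1) c
        by (auto simp: edge_cycle_def P_def abr r successively_append_iff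
            successively_Cons hd_append insert_commute split: if_splits)
      then show False using acyc by blast
    qed
  qed
  then show ?thesis using ab by blast
qed

lemma acyclic_parent:
  assumes "finite F" "\<And>e. e \<in> F \<Longrightarrow> card e = 2" "\<nexists>p. edge_cycle F p"
  shows "\<exists>(par :: 'a \<Rightarrow> 'a) (d :: 'a \<Rightarrow> nat). \<forall>e\<in>F. \<exists>v. e = {v, par v} \<and> d v = Suc (d (par v))"
  using assms
proof (induction F rule: finite_psubset_induct)
  case (psubset F)
  show ?case
  proof (cases "F = {}")
    case False
    then obtain a b where ab: "a \<noteq> b" "{a, b} \<in> F" "\<And>e. e \<in> F \<Longrightarrow> a \<in> e \<Longrightarrow> e = {a, b}"
      using acyclic_leaf[OF psubset(1) psubset(3,4)] by metis
    let ?F = "F - {{a, b}}"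
    have "\<nexists>p. edge_cycle ?F p"
    proof
      assume "\<exists>p. edge_cycle ?F p"
      then obtain p where "edge_cycle ?F p" by blast
      then have "edge_cycle F p"
        unfolding edge_cycle_def by (blast intro: successively_mono)
      then show False using psubset.prems by blast
    qed
    moreover have "?F \<subset> F" using ab(2) by blast
    moreover have "\<And>e. e \<in> ?F \<Longrightarrow> card e = 2" using psubset.prems(1) by blast
    ultimately have "\<exists>(par :: 'a \<Rightarrow> 'a) (d :: 'a \<Rightarrow> nat).
        \<forall>e\<in>?F. \<exists>v. e = {v, par v} \<and> d v = Suc (d (par v))"
      by (intro psubset.IH) simp_all
    then obtain par :: "'a \<Rightarrow> 'a" and d :: "'a \<Rightarrow> nat" where
      pd: "\<forall>e\<in>?F. \<exists>v. e = {v, par v} \<and> d v = Suc (d (par v))"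
      by (elim exE)
    \<comment> \<open>The leaf \<open>a\<close> lies on no other edge, so its parent and depth can be chosen freely.\<close>
    have "\<exists>v. e = {v, (par(a := b)) v} \<and> (d(a := Suc (d b))) v = Suc ((d(a := Suc (d b))) ((par(a := b)) v))"
      if e: "e \<in> F" for e
    proof (cases "e = {a, b}")
      case True
      then show ?thesis using ab(1) by (intro exI[of _ a]) auto
    next
      case False
      then obtain v where v: "e = {v, par v}" "d v = Suc (d (par v))" using pd e by blast
      have "a \<notin> e" using False e ab(3) by blast
      then show ?thesis using v by (intro exI[of _ v]) auto
    qed
    then show ?thesis by blast
  qed simp
qed

section \<open>Line graphs of forests\<close>

lemma closed_nbhd_line_graph:
  assumes "e \<in> F" "e \<noteq> {}"
  shows "closed_nbhd (line_graph F) e = {g \<in> F. g \<inter> e \<noteq> {}}"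
proof -
  have "verts (line_graph F) = F" by (simp add: line_graph_def)
  then show ?thesis
    using assms by (auto simp: closed_nbhd_def adjacent_line_graph)
qed

lemma line_graph_simple_edge:
  assumes fin: "finite F" and card: "\<And>e. e \<in> F \<Longrightarrow> card e = 2"
    and acyc: "\<nexists>p. edge_cycle F p" and S: "S \<subseteq> F" "S \<noteq> {}"
  shows "\<exists>e\<in>S. \<exists>t\<in>closed_nbhd (line_graph F) e. \<forall>h\<in>S.
    closed_nbhd (line_graph F) h \<inter> closed_nbhd (line_graph F) e \<noteq> {} \<longrightarrow>
    t \<in> closed_nbhd (line_graph F) h"
proof -
  obtain par :: "'a \<Rightarrow> 'a" and d :: "'a \<Rightarrow> nat" where
    pd: "\<And>e. e \<in> F \<Longrightarrow> \<exists>v. e = {v, par v} \<and> d v = Suc (d (par v))"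
    using acyclic_parent[OF fin card acyc] by blast
  have ne: "e \<noteq> {}" if "e \<in> F" for e using card[OF that] by auto
  define V where "V = {v. {v, par v} \<in> S \<and> d v = Suc (d (par v))}"
  have "V \<subseteq> \<Union>F" using S by (auto simp: V_def)
  moreover have "finite (\<Union>F)" using fin card by (intro finite_Union) (simp_all add: card_ge_0_finite)
  ultimately have "finite V" by (rule finite_subset)
  moreover have "V \<noteq> {}" using S pd by (fastforce simp: V_def)
  ultimately have "Max (d ` V) \<in> d ` V" by simp
  then obtain v where v: "v \<in> V" and "d v = Max (d ` V)" by auto
  then have vmax: "d x \<le> d v" if "x \<in> V" for x
    using that \<open>finite V\<close> by simp
  define p where "p = par v"
  let ?e = "{v, p}"
  have e: "?e \<in> S" "?e \<in> F" and dv: "d v = Suc (d p)"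
    using v S by (auto simp: V_def p_def)
  define t where "t = (if {p, par p} \<in> F then {p, par p} else ?e)"
  have t: "t \<in> F" "p \<in> t" using e by (auto simp: t_def)
  have "t \<inter> h \<noteq> {}" if h: "h \<in> S" and g: "g \<in> F" "g \<inter> h \<noteq> {}" "g \<inter> ?e \<noteq> {}" for h g
  proof -
    obtain x where x: "h = {x, par x}" "d x = Suc (d (par x))" using pd h S by blast
    have "d x \<le> d v" using vmax x h by (simp add: V_def)
    obtain y where y: "g = {y, par y}" "d y = Suc (d (par y))" using pd g(1) by blast
    show ?thesis
    proof (cases "p \<in> h \<or> y = p")
      case True
      \<comment> \<open>If \<open>y = p\<close> then \<open>g\<close> is the edge above \<open>p\<close>, that is \<open>g = t\<close>.\<close>
      then show ?thesis using t(2) g(1,2) y(1) by (auto simp: t_def)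
    next
      case False
      \<comment> \<open>Here \<open>y = v\<close>, \<open>par y = v\<close> or \<open>par y = p\<close>. An edge that avoids \<open>p\<close> and meets such a \<open>g\<close>
        has its lower end strictly deeper than \<open>v\<close>, against the choice of \<open>v\<close>.\<close>
      then show ?thesis
        using g(2,3) x y dv \<open>d x \<le> d v\<close> by (auto simp: p_def)
    qed
  qed
  then have "\<forall>h\<in>S. closed_nbhd (line_graph F) h \<inter> closed_nbhd (line_graph F) ?e \<noteq> {} \<longrightarrow>
      t \<in> closed_nbhd (line_graph F) h"
    using S t(1) e(2) ne by (auto simp: closed_nbhd_line_graph subset_iff)
  moreover have "t \<in> closed_nbhd (line_graph F) ?e"
    using t e(2) by (auto simp: closed_nbhd_line_graph)
  ultimately show ?thesis using e(1) by blast
qed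

theorem theorem4p1:
  fixes T :: "'a ugraph" and F :: "'a set set" and w :: "'a set \<Rightarrow> nat"
  assumes "finite_tree T" and "F \<subseteq> edges T"
  shows "wdom_number (line_graph F) w = disp_number (line_graph F) w"
proof (rule wdom_number_eq_disp_number)
  have T: "simple_graph T" and acycT: "\<nexists>p. graph_cycle T p"
    using assms(1) by (auto simp: finite_tree_def)
  show G: "simple_graph (line_graph F)"
    using T assms(2) by (rule simple_graph_line_graph)
  then have fin: "finite F" by (simp add: simple_graph_def line_graph_def)
  have FT: "e \<subseteq> verts T" "card e = 2" if "e \<in> F" for e
    using T assms(2) that by (auto simp: simple_graph_def)
  have acyc: "\<nexists>p. edge_cycle F p"
  proof
    assume "\<exists>p. edge_cycle F p"
    then obtain p where p: "edge_cycle F p" by blast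
    have succ: "successively (adjacent T) p"
      using p assms(2) unfolding edge_cycle_def
      by (auto simp: adjacent_def elim!: successively_mono)
    have "set p \<subseteq> \<Union>F"
      using p by (intro path_verts_subset_Union) (auto simp: edge_cycle_def)
    then have "set p \<subseteq> verts T" using FT(1) by blast
    then have "graph_cycle T p"
      using p succ assms(2) by (auto simp: edge_cycle_def graph_cycle_def walk_def adjacent_def)
    then show False using acycT by blast
  qed
  show "\<exists>e\<in>S. \<exists>t\<in>closed_nbhd (line_graph F) e. \<forall>h\<in>S.
      closed_nbhd (line_graph F) h \<inter> closed_nbhd (line_graph F) e \<noteq> {} \<longrightarrow>
      t \<in> closed_nbhd (line_graph F) h"
    if "S \<subseteq> verts (line_graph F)" "S \<noteq> {}" for S
    using line_graph_simple_edge[OF fin FT(2) acyc] that by (simp add: line_graph_def)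
qed

end
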